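(* Let $T$ be a semi-infinite banded stochastic matrix admitting a positive bidiagonal factorization, let $N\in\mathbb N_0$, and let $\hat T^{[N]}=\frac{1}{\lambda_0^{[N]}}\delta(u_0^{\langle N\rangle})^{-1}T^{[N]}\delta(u_0^{\langle N\rangle})$ be the stochastic matrix obtained by Perron normalization of the truncation $T^{[N]}$. Then the finite Markov chain on $\{0,1,\dots,N\}$ with transition matrix $\hat T^{[N]}$ has only one class, i.e. it is irreducible.
   Context: Semi-infinite matrices are indexed by $\mathbb N_0=\{0,1,2,\dots\}$. Fix integers $p,q\ge1$. $T$ is banded: $T_{n,m}=0$ unless $n-p\le m\le n+q$, with positive entries inside the band. A matrix is stochastic if its entries are nonnegative and every row sums to $1$. A positive bidiagonal factorization of $T$ is a factorization $T=\mathscr L_1\cdots\mathscr L_p\mathscr U_q\cdots\mathscr U_1$ where each $\mathscr L_i$ is lower bidiagonal with positive entries on the main diagonal and first subdiagonal (all other entries zero) and each $\mathscr U_j$ is upper bidiagonal with positive entries on the main diagonal and first superdiagonal (all other entries zero). For a vector $v$, $\delta(v)$ is the diagonal matrix with diagonal entries the entries of $v$. $T^{[N]}=(T_{n,m})_{n,m=0}^N$. Its eigenvalues $\lambda_0^{[N]}>\dots>\lambda_N^{[N]}$ are simple and positive (known), and $u_0^{\langle N\rangle}$ is a right eigenvector of $T^{[N]}$ for $\lambda_0^{[N]}$ with all entries positive (unique up to positive scaling). Two states $i,j$ are in the same class (communicate) if there are $n,n'\in\mathbb N$ with $((\hat T^{[N]})^n)_{i,j}>0$ and $((\hat T^{[N]})^{n'})_{j,i}>0$;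 the chain is irreducible if there is only one class. *)

theory Defs
  imports
    Complex_Main
    "Jordan_Normal_Form.Matrix"
    "Jordan_Normal_Form.Spectral_Radius"
begin

section \<open>Semi-infinite matrices\<close>

type_synonym semi_inf_mat = "nat \<Rightarrow> nat \<Rightarrow> real"

text \<open>The matrix product. It is only used with a left factor all of whose rows are
  finitely supported, so every series below is a finite sum (see \<open>simat_mult_finite\<close>).\<close>

definition simat_mult :: "semi_inf_mat \<Rightarrow> semi_inf_mat \<Rightarrow> semi_inf_mat" where
  "simat_mult A B = (\<lambda>n m. \<Sum>k. A n k * B k m)"

definition simat_one :: semi_inf_mat where
  "simat_one = (\<lambda>n m. if n = m then 1 else 0)"

definition simat_prod_list :: "semi_inf_mat list \<Rightarrow> semi_inf_mat" where
  "simat_prod_list Ms = foldr simat_mult Ms simat_one"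

lemma simat_mult_finite:
  assumes "finite K" and "\<And>k. k \<notin> K \<Longrightarrow> A n k = 0"
  shows "simat_mult A B n m = (\<Sum>k\<in>K. A n k * B k m)"
  unfolding simat_mult_def by (rule suminf_finite) (use assms in auto)

text \<open>The band condition \<open>n - p \<le> m\<close> is written additively because subtraction on
  natural numbers truncates.\<close>

definition positive_banded :: "nat \<Rightarrow> nat \<Rightarrow> semi_inf_mat \<Rightarrow> bool" where
  "positive_banded p q T \<longleftrightarrow>
     (\<forall>n m. if n \<le> m + p \<and> m \<le> n + q then T n m > 0 else T n m = 0)"

definition stochastic_simat :: "semi_inf_mat \<Rightarrow> bool" where
  "stochastic_simat T \<longleftrightarrow> (\<forall>n m. T n m \<ge> 0) \<and> (\<forall>n. (\<lambda>m. T n m) sums 1)"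

definition positive_lower_bidiagonal :: "semi_inf_mat \<Rightarrow> bool" where
  "positive_lower_bidiagonal L \<longleftrightarrow>
     (\<forall>n m. if n = m \<or> n = Suc m then L n m > 0 else L n m = 0)"

definition positive_upper_bidiagonal :: "semi_inf_mat \<Rightarrow> bool" where
  "positive_upper_bidiagonal U \<longleftrightarrow>
     (\<forall>n m. if m = n \<or> m = Suc n then U n m > 0 else U n m = 0)"

text \<open>\<open>T = L\<^sub>1 \<cdots> L\<^sub>p U\<^sub>q \<cdots> U\<^sub>1\<close>; note the decreasing order of the upper factors.\<close>

definition has_positive_bidiagonal_factorization :: "nat \<Rightarrow> nat \<Rightarrow> semi_inf_mat \<Rightarrow> bool" where
  "has_positive_bidiagonal_factorization p q T \<longleftrightarrow>
     (\<exists>L U. (\<forall>i\<in>{1..p}. positive_lower_bidiagonal (L i)) \<and>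
            (\<forall>j\<in>{1..q}. positive_upper_bidiagonal (U j)) \<and>
            T = simat_prod_list (map L [1..<p+1] @ map U (rev [1..<q+1])))"

definition truncation :: "semi_inf_mat \<Rightarrow> nat \<Rightarrow> real mat" where
  "truncation T N = mat (N+1) (N+1) (\<lambda>(n,m). T n m)"


section \<open>Perron normalization\<close>

definition largest_eigenvalue :: "real mat \<Rightarrow> real" where
  "largest_eigenvalue A = Max (spectrum A)"

definition diag_of_vec :: "real vec \<Rightarrow> real mat" where
  "diag_of_vec v = mat_diag (dim_vec v) (\<lambda>i. v $ i)"

definition diag_of_vec_inv :: "real vec \<Rightarrow> real mat" where
  "diag_of_vec_inv v = mat_diag (dim_vec v) (\<lambda>i. inverse (v $ i))"

lemma diag_of_vec_inv:
  assumes "\<forall>i < dim_vec v. v $ i \<noteq> 0"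
  shows "inverts_mat (diag_of_vec v) (diag_of_vec_inv v)"
    and "inverts_mat (diag_of_vec_inv v) (diag_of_vec v)"
  using assms
  by (auto simp: inverts_mat_def diag_of_vec_def diag_of_vec_inv_def mat_diag_def intro!: eq_matI
      simp flip: mat_diag_def) (auto simp: mat_diag_def)

definition perron_normalization :: "real mat \<Rightarrow> real vec \<Rightarrow> real mat" where
  "perron_normalization A u =
     (1 / largest_eigenvalue A) \<cdot>\<^sub>m (diag_of_vec_inv u * A * diag_of_vec u)"


section \<open>Finite Markov chains\<close>

definition stochastic_mat :: "real mat \<Rightarrow> bool" where
  "stochastic_mat P \<longleftrightarrow> square_mat P \<and>
     (\<forall>i < dim_row P. \<forall>j < dim_row P. P $$ (i,j) \<ge> 0) \<and>
     (\<forall>i < dim_row P. (\<Sum>j < dim_row P. P $$ (i,j)) = 1)"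

text \<open>The exponents range over the positive integers, i.e. communication of a state with
  itself also requires a genuine return to that state.\<close>

definition communicate :: "real mat \<Rightarrow> nat \<Rightarrow> nat \<Rightarrow> bool" where
  "communicate P i j \<longleftrightarrow>
     (\<exists>n\<ge>1. (P ^\<^sub>m n) $$ (i,j) > 0) \<and> (\<exists>n'\<ge>1. (P ^\<^sub>m n') $$ (j,i) > 0)"

definition communicating_classes :: "real mat \<Rightarrow> nat set set" where
  "communicating_classes P =
     {..<dim_row P} // {(i,j). i < dim_row P \<and> j < dim_row P \<and> communicate P i j}"

text \<open>There is only one class, which then is the whole state space.\<close>

definition irreducible_chain :: "real mat \<Rightarrow> bool" where
  "irreducible_chain P \<longleftrightarrow> communicating_classes P = {{..<dim_row P}}"

lemma irreducible_chain_iff: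
  assumes "dim_row P > 0"
  shows "irreducible_chain P \<longleftrightarrow> (\<forall>i < dim_row P. \<forall>j < dim_row P. communicate P i j)"
proof
  assume *: "irreducible_chain P"
  show "\<forall>i < dim_row P. \<forall>j < dim_row P. communicate P i j"
  proof (intro allI impI)
    fix i j assume ij: "i < dim_row P" "j < dim_row P"
    let ?R = "{(i,j). i < dim_row P \<and> j < dim_row P \<and> communicate P i j}"
    have "?R `` {i} \<in> communicating_classes P"
      unfolding communicating_classes_def using ij by (intro quotientI) auto
    then have "?R `` {i} = {..<dim_row P}" using * unfolding irreducible_chain_def by blast
    then have "j \<in> ?R `` {i}" using ij by blast
    then show "communicate P i j" by blast
  qed
next
  assume "\<forall>i < dim_row P. \<forall>j < dim_row P. communicate P i j"
  then show "irreducible_chain P"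
    using assms unfolding irreducible_chain_def communicating_classes_def quotient_def by auto
qed

lemma perron_normalization_stochastic:
  assumes T: "stochastic_simat T" and pos: "\<forall>n\<le>N. T n n > 0"
    and ev: "eigenvector (truncation T N) u (largest_eigenvalue (truncation T N))"
    and u: "\<forall>i\<le>N. u $ i > 0"
  shows "stochastic_mat (perron_normalization (truncation T N) u)"
proof -
  let ?A = "truncation T N"
  define l where "l = largest_eigenvalue ?A"
  have A: "?A \<in> carrier_mat (Suc N) (Suc N)" by (simp add: truncation_def)
  have dim: "dim_vec u = Suc N" using ev A unfolding eigenvector_def by auto
  have row: "(\<Sum>j<Suc N. T i j * u $ j) = l * u $ i" if "i < Suc N" for i
  proof -
    have "(?A *\<^sub>v u) $ i = (l \<cdot>\<^sub>v u) $ i" using ev unfolding eigenvector_def l_def by simp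
    then show ?thesis using that dim
      by (simp add: truncation_def scalar_prod_def atLeast0LessThan del: sum.lessThan_Suc)
  qed
  have "0 < T 0 0 * u $ 0" using u pos by auto
  also have "\<dots> \<le> (\<Sum>j<Suc N. T 0 j * u $ j)"
    by (rule member_le_sum)
      (use T u in \<open>auto simp: stochastic_simat_def less_Suc_eq_le less_imp_le intro!: mult_nonneg_nonneg\<close>)
  also have "\<dots> = l * u $ 0" by (rule row) simp
  finally have l: "l > 0" using u[rule_format, of 0] by (simp add: zero_less_mult_iff)
  have inv: "diag_of_vec_inv u * ?A = mat (Suc N) (Suc N) (\<lambda>(i,j). inverse (u $ i) * ?A $$ (i,j))"
    unfolding diag_of_vec_inv_def dim by (rule mat_diag_mult_left[OF A])
  have "diag_of_vec_inv u * ?A * diag_of_vec u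
      = mat (Suc N) (Suc N) (\<lambda>(i,j). (diag_of_vec_inv u * ?A) $$ (i,j) * u $ j)"
    unfolding diag_of_vec_def dim by (rule mat_diag_mult_right) (simp add: inv)
  also have "\<dots> = mat (Suc N) (Suc N) (\<lambda>(i,j). inverse (u $ i) * T i j * u $ j)"
    unfolding inv by (intro eq_matI) (auto simp: truncation_def)
  finally have P: "perron_normalization ?A u
      = mat (Suc N) (Suc N) (\<lambda>(i,j). T i j * u $ j / (l * u $ i))"
    unfolding perron_normalization_def l_def[symmetric]
    by (intro eq_matI) (auto simp: field_simps)
  have "(\<Sum>j<Suc N. T i j * u $ j / (l * u $ i)) = 1" if "i < Suc N" for i
    unfolding sum_divide_distrib[symmetric] row[OF that]
    using l u[rule_format, of i] that by (simp add: less_Suc_eq_le)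
  moreover have "0 \<le> T i j * u $ j / (l * u $ i)" if "i < Suc N" "j < Suc N" for i j
    using T l u that by (auto simp: stochastic_simat_def less_Suc_eq_le less_imp_le)
  ultimately show ?thesis unfolding stochastic_mat_def P
    by (simp add: less_imp_le del: sum.lessThan_Suc)
qed

end

theory Submission
  imports Defs
begin

text \<open>Conjugating by the positive diagonal matrix of \<open>u\<close> and dividing by the
  positive number \<open>l\<close> leaves the pattern of zero and positive entries of the truncation
  intact. Since \<open>p\<close> and \<open>q\<close> are at least 1, the band contains the main
  diagonal and both neighbouring diagonals, so the chain can stay put or move to either neighbour
  with positive probability. Walking along the line and idling when there is time to spare, it gets
  from any state to any other in exactly \<open>N + 1\<close> steps.
  \<open>pow_mat_pos_tridiagonal\<close> carries the walk, \<open>perron_normalization_index\<close>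
  the transfer of the sign pattern.\<close>

lemma pow_mat_nonneg:
  fixes P :: "real mat"
  assumes P: "P \<in> carrier_mat d d"
    and nonneg: "\<And>i j. i < d \<Longrightarrow> j < d \<Longrightarrow> P $$ (i,j) \<ge> 0"
    and "i < d" "j < d"
  shows "(P ^\<^sub>m n) $$ (i,j) \<ge> 0"
  using \<open>i < d\<close> \<open>j < d\<close>
proof (induction n arbitrary: i j)
  case 0
  then show ?case using P by simp
next
  case (Suc n)
  have "(P ^\<^sub>m Suc n) $$ (i,j) = (\<Sum>k = 0..<d. (P ^\<^sub>m n) $$ (i,k) * P $$ (k,j))"
    using P Suc.prems pow_carrier_mat[OF P, of n] by (simp add: scalar_prod_def)
  also have "\<dots> \<ge> 0"
    using Suc nonneg by (intro sum_nonneg mult_nonneg_nonneg) auto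
  finally show ?case .
qed

text \<open>The last two assumptions say that i and j are at distance at most \<open>n\<close>. A
  path of nearest-neighbour moves then exists, and the positive diagonal pads it to length exactly
  \<open>n\<close>; all other paths contribute nonnegatively.\<close>

lemma pow_mat_pos_tridiagonal:
  fixes P :: "real mat"
  assumes P: "P \<in> carrier_mat d d"
    and nonneg: "\<And>i j. i < d \<Longrightarrow> j < d \<Longrightarrow> P $$ (i,j) \<ge> 0"
    and pos: "\<And>i j. i < d \<Longrightarrow> j < d \<Longrightarrow> i \<le> Suc j \<Longrightarrow> j \<le> Suc i \<Longrightarrow> P $$ (i,j) > 0"
    and "i < d" "j < d" "i \<le> j + n" "j \<le> i + n"
  shows "(P ^\<^sub>m n) $$ (i,j) > 0"
  using \<open>i < d\<close> \<open>j < d\<close> \<open>i \<le> j + n\<close> \<open>j \<le> i + n\<close>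
proof (induction n arbitrary: j)
  case 0
  then show ?case using P by simp
next
  case (Suc n)
  \<comment> \<open>\<open>k\<close> is the state visited just before \<open>j\<close>: one place
    closer to \<open>i\<close>, or \<open>j\<close> itself when the two coincide. It lies between
    \<open>i\<close> and \<open>j\<close>, hence in range, and within distance \<open>n\<close> of
    \<open>i\<close>.\<close>
  define k where "k = (if i < j then j - 1 else if j < i then j + 1 else j)"
  have k: "k < d" "i \<le> k + n" "k \<le> i + n" "k \<le> Suc j" "j \<le> Suc k"
    using Suc.prems by (auto simp: k_def)
  have "0 < (P ^\<^sub>m n) $$ (i,k) * P $$ (k,j)"
    using k Suc pos by auto
  also have "\<dots> \<le> (\<Sum>k = 0..<d. (P ^\<^sub>m n) $$ (i,k) * P $$ (k,j))"
    using k Suc.prems nonneg pow_mat_nonneg[OF P nonneg]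
    by (intro member_le_sum mult_nonneg_nonneg) auto
  also have "\<dots> = (P ^\<^sub>m Suc n) $$ (i,j)"
    using P Suc.prems pow_carrier_mat[OF P, of n] by (simp add: scalar_prod_def)
  finally show ?case .
qed

text \<open>Distances between states are below \<open>d\<close>, so the single exponent
  \<open>d\<close> serves all pairs in both directions; being positive, it also meets the bound on
  exponents in \<open>communicate\<close>.\<close>

lemma irreducible_chain_tridiagonal:
  fixes P :: "real mat"
  assumes P: "P \<in> carrier_mat d d" and d: "d > 0"
    and nonneg: "\<And>i j. i < d \<Longrightarrow> j < d \<Longrightarrow> P $$ (i,j) \<ge> 0"
    and pos: "\<And>i j. i < d \<Longrightarrow> j < d \<Longrightarrow> i \<le> Suc j \<Longrightarrow> j \<le> Suc i \<Longrightarrow> P $$ (i,j) > 0"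
  shows "irreducible_chain P"
proof -
  have "(P ^\<^sub>m d) $$ (i,j) > 0" if "i < d" "j < d" for i j
    using that by (intro pow_mat_pos_tridiagonal[OF P nonneg pos]) auto
  then have "communicate P i j" if "i < d" "j < d" for i j
    using that d unfolding communicate_def by (metis Suc_leI One_nat_def)
  then show ?thesis
    using P d by (auto simp: irreducible_chain_iff)
qed

lemma perron_normalization_carrier:
  assumes "A \<in> carrier_mat d d" and "dim_vec u = d"
  shows "perron_normalization A u \<in> carrier_mat d d"
  using assms by (auto simp: perron_normalization_def diag_of_vec_def diag_of_vec_inv_def mat_diag_def)

lemma perron_normalization_index:
  assumes A: "A \<in> carrier_mat d d" and u: "dim_vec u = d" and ij: "i < d" "j < d"
  shows "perron_normalization A u $$ (i,j) =
    A $$ (i,j) * u $ j / u $ i / largest_eigenvalue A"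
proof -
  have "diag_of_vec_inv u * A = mat d d (\<lambda>(i,j). inverse (u $ i) * A $$ (i,j))"
    unfolding diag_of_vec_inv_def u by (rule mat_diag_mult_left[OF A])
  moreover from this have "diag_of_vec_inv u * A * diag_of_vec u
      = mat d d (\<lambda>(i,j). (diag_of_vec_inv u * A) $$ (i,j) * u $ j)"
    unfolding diag_of_vec_def u by (intro mat_diag_mult_right) simp
  ultimately show ?thesis
    using ij by (simp add: perron_normalization_def divide_simps)
qed

theorem proposition2p6:
  fixes T :: "nat \<Rightarrow> nat \<Rightarrow> real" and p q N :: nat and u :: "real vec"
  assumes "p \<ge> 1" and "q \<ge> 1"
    and "positive_banded p q T"
    and "stochastic_simat T"
    and "has_positive_bidiagonal_factorization p q T"
    and "eigenvector (truncation T N) u (largest_eigenvalue (truncation T N))"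
    and "\<forall>i\<le>N. u $ i > 0"
  shows "irreducible_chain (perron_normalization (truncation T N) u)"
proof -
  let ?A = "truncation T N"
  define l where "l = largest_eigenvalue ?A"
  define P where "P = perron_normalization ?A u"
  have A: "?A \<in> carrier_mat (Suc N) (Suc N)" by (simp add: truncation_def)
  have u: "dim_vec u = Suc N" using assms(6) A unfolding eigenvector_def by auto
  have T: "T i j > 0" if "i \<le> Suc j" "j \<le> Suc i" for i j
  proof -
    have "i \<le> j + p \<and> j \<le> i + q" using that assms(1,2) by linarith
    then show ?thesis using assms(3) unfolding positive_banded_def by metis
  qed
  have P: "P \<in> carrier_mat (Suc N) (Suc N)"
    unfolding P_def by (rule perron_normalization_carrier[OF A u])
  have P_index: "P $$ (i,j) = T i j * u $ j / u $ i / l" if "i < Suc N" "j < Suc N" for i j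
    using perron_normalization_index[OF A u that] that
    by (simp add: P_def l_def truncation_def)
  have "stochastic_mat P"
    unfolding P_def using assms T by (intro perron_normalization_stochastic) auto
  then have nonneg: "P $$ (i,j) \<ge> 0" and row: "(\<Sum>j<Suc N. P $$ (i,j)) = 1"
    if "i < Suc N" "j < Suc N" for i j
    using P that unfolding stochastic_mat_def by auto
  \<comment> \<open>Division by zero yields 0, so \<open>l = 0\<close> would make row 0 of
    \<open>P\<close> vanish, although it sums to 1.\<close>
  have "l \<noteq> 0"
    using row[of 0 0] P_index[of 0] by (auto simp del: sum.lessThan_Suc)
  \<comment> \<open>The entry \<open>P $$ (0,0)\<close> is nonnegative and equals a positive number
    divided by \<open>l\<close>.\<close>
  moreover have "l \<ge> 0"
    using nonneg[of 0 0] P_index[of 0 0] T[of 0 0] assms(7)[rule_format, of 0]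
    by (auto simp: zero_le_divide_iff)
  ultimately have l: "l > 0" by simp
  have "P $$ (i,j) > 0" if "i < Suc N" "j < Suc N" "i \<le> Suc j" "j \<le> Suc i" for i j
    using that P_index[of i j] T[of i j] l assms(7) by simp
  then show ?thesis
    using irreducible_chain_tridiagonal[OF P] nonneg by (simp add: P_def)
qed

end
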